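(* Let $A$ be a threshold automaton with counter system $CS(A)$ and abstract counter system $ACS(\overline A)=(\overline\Sigma,\overline\Sigma_0,\overline{\mathcal T})$, and let $ERR\subseteq\overline\Sigma$ be finite. The General Parameterized Coverability Checking algorithm (described in the context), run on input $ACS(\overline A)$ and $ERR$, is complete: if $ACS(\overline A)$ has a non-spurious error path, i.e. a non-spurious path starting in $\overline\Sigma_0$ and ending in ${\uparrow}ERR$, then the algorithm will find it, in the sense that it terminates and returns a non-spurious error path.
   Context: **Threshold automaton.** A threshold automaton is $A=(L,\mathcal I,\Gamma,\Pi,\mathcal R,RC)$, where: $L$ is a finite set of locations; $\mathcal I\subseteq L$ is the set of initial locations; $\Gamma=\{x_0,\dots,x_m\}$ is a finite set of shared variables over $\mathbb N_0$; $\Pi$ is a finite set of parameter variables over $\mathbb N_0$; $RC$ (resilience condition) is a linear integer arithmetic formula over $\Pi$, and $\mathbf P_{RC}=\{\mathbf p\in\mathbb N_0^{|\Pi|}:\mathbf p\models RC\}$ is the set of admissible parameter vectors; $\mathcal R$ is a finite set of rules $r=(from,to,\varphi,\mathbf{uv},\tau)$ with $from,to\in L$, update vector $\mathbf{uv}\in\mathbb Z^{|\Gamma|}$ with entries in $\{-1,0,1\}$, $\tau\subseteq\Gamma$ the set of variables reset to $0$, and guard $\varphi$ a conjunction of lower guards $a_0+\sum_i a_ip_i\le x$ and upper guards $a_0+\sum_i a_ip_i>x$ ($x\in\Gamma$, $p_i\in\Pi$, $a_i\in\mathbb Q$). The left-hand side of a guard is called a threshold. A function $N:\mathbf P_{RC}\to\mathbb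 N_0$, given by a linear expression in the parameters, gives the number of modelled processes. **Counter system $CS(A)=(\Sigma,\Sigma_0,\mathcal T)$.** $\Sigma$ is the set of configurations $\sigma=(\mathbf k,\mathbf g,\mathbf p)$ with $\mathbf k\in\mathbb N_0^{|L|}$, $\mathbf g\in\mathbb N_0^{|\Gamma|}$, $\mathbf p\in\mathbf P_{RC}$. $\Sigma_0$: all $\sigma$ with $\mathbf g=0$, $\sum_{i\in\mathcal I}\mathbf k[i]=N(\mathbf p)$, $\sum_{i\notin\mathcal I}\mathbf k[i]=0$. $(\sigma,r,\sigma')\in\mathcal T$ iff $\sigma'.\mathbf p=\sigma.\mathbf p$; one process moves from $r.from$ to $r.to$ (i.e. $\sigma.\mathbf k[r.from]\ge1$ and $\sigma'.\mathbf k=\sigma.\mathbf k-\mathbf u_{r.from}+\mathbf u_{r.to}$, $\mathbf u_i$ the $i$-th unit vector); $\sigma.\mathbf g$ (with $\sigma.\mathbf p$) satisfies $r.\varphi$; and $\sigma'.\mathbf g[i]=0$ if $x_i\in r.\tau$, $\sigma'.\mathbf g[i]=\sigma.\mathbf g[i]+r.\mathbf{uv}[i]$ otherwise. A path of $CS(A)$ is a finite alternating sequence $\sigma_0,r_0,\sigma_1,\dots,r_{k-1},\sigma_k$ with $\sigma_0\in\Sigma_0$ and $(\sigma_i,r_i,\sigma_{i+1})\in\mathcal T$. **Abstract threshold automaton.** Let $\{d_0,\dots,d_k\}$ with $d_0=0$, $d_1=1$ and $d_i$ ($i>1$) the thresholds of $A$, indexed so that $d_i<d_j$ whenever $i<j$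 (different admissible parameters inducing different orders are treated as separate cases, so one order is fixed). Let $\mathcal D=\{I_0,\dots,I_k\}$ with $I_i=[d_i,d_{i+1}[$ for $i<k$ and $I_k=[d_k,\infty[$. $\overline A=(L,\mathcal I,\overline\Gamma,\Pi,\overline{\mathcal R})$ has variables $\overline x_i$ over $\mathcal D$ and abstract rules $\overline r=(from,to,\overline\varphi,\mathbf{uv},\tau)$, where $\overline\varphi$ is obtained from $\varphi$ by replacing each conjunct $d_j\le x$ by $\bigvee_{c\ge j}(\overline x=I_c)$ and each conjunct $d_j>x$ by $\bigvee_{c<j}(\overline x=I_c)$. **Abstract counter system $ACS(\overline A)=(\overline\Sigma,\overline\Sigma_0,\overline{\mathcal T})$.** $\overline\Sigma$ is the set of $\overline\sigma=(\mathbf k,\overline{\mathbf g})$ with $\mathbf k\in\mathbb N_0^{|L|}$, $\overline{\mathbf g}\in\mathcal D^{|\Gamma|}$. $\overline\Sigma_0$: all entries of $\overline{\mathbf g}$ are $I_0$ and $\mathbf k[i]=0$ for $i\notin\mathcal I$. $(\overline\sigma,\overline r,\overline\sigma')\in\overline{\mathcal T}$ iff one process moves from $\overline r.from$ to $\overline r.to$ (i.e. $\overline\sigma.\mathbf k[\overline r.from]\ge1$ and $\overline\sigma'.\mathbf k=\overline\sigma.\mathbf k-\mathbf u_{\overline r.from}+\mathbf u_{\overline r.to}$, $\mathbf u_i$ the $i$-th unit vector), $\overline\sigma.\overline{\mathbf g}\models\overline r.\overline\varphi$, and for each $i$: if $x_i\in\overline r.\tau$ the new interval is $I_0$; otherwise,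 if $\mathbf{uv}[i]=0$ it is unchanged; if $\mathbf{uv}[i]=1$ it is unchanged or the next interval (it must be the next one if the old interval is $I_0$; $I_k$ has no next); if $\mathbf{uv}[i]=-1$ it is unchanged or the previous interval (unchanged if it is $I_0$). Paths of $ACS(\overline A)$ are finite alternating sequences of configurations and rules following $\overline{\mathcal T}$ and starting in $\overline\Sigma_0$. **Order.** $(\mathbf k,\overline{\mathbf g})\lesssim(\mathbf k',\overline{\mathbf g}')$ iff $\mathbf k\le\mathbf k'$ component-wise and $\overline{\mathbf g}=\overline{\mathbf g}'$; ${\uparrow}R=\{s\mid\exists s'\in R:\ s'\lesssim s\}$. **Non-spurious (for coverability).** An alternating sequence $\overline\pi=\overline\sigma_0,\overline r_0,\dots,\overline r_{m-1},\overline\sigma_m$ of abstract configurations and rules is non-spurious if $Concretize(\overline\pi)\wedge Cover(\overline\pi)$ is satisfiable, i.e. if there is a path of $CS(A)$ of the form $\sigma_0,r_0^{c_0},\sigma_1,\dots,r_{m-1}^{c_{m-1}},\sigma_m$ (where $r_i^{c_i}$ means applying $r_i$ consecutively $c_i\in\mathbb N_0$ times, $r_i$ being the concrete rule of $\overline r_i$) such that for all $i<m$: $\sigma_i.\mathbf k[r_i.from]=c_i+\sigma_{i+1}.\mathbf k[r_i.from]$ and $\sigma_{i+1}.\mathbf k[r_i.to]=c_i+\sigma_i.\mathbf k[r_i.to]$ when $r_i.from\ne r_i.to$; $\sigma_{i+1}.\mathbf g[j]=\sigma_i.\mathbf g[j]+c_i\,r_i.\mathbf{uv}[j]$ for $x_j\notin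 r_i.\tau$; $\sigma_{i+1}.\mathbf g[j]=0$ for $x_j\in r_i.\tau$; if $c_i>1$ then $\sigma_{i+1}.\mathbf g-r_i.\mathbf{uv}\models r_i.\varphi$; moreover $\sigma_i.\mathbf g[j]\in\overline\sigma_i.\overline{\mathbf g}[j]$ for all $i\le m$ and all $j$, and ($Cover$) $\sigma_m.\mathbf k[l]\ge\overline\sigma_m.\mathbf k[l]$ for all $l\in L$. **The algorithm.** For $E'\subseteq\overline\Sigma$, $BasisTrans(E')$ is the set of triples $((\mathbf k,\overline{\mathbf g}),\overline r,(\mathbf k',\overline{\mathbf g}'))\in\overline\Sigma\times\overline{\mathcal R}\times\overline\Sigma$ such that $(\mathbf k',\overline{\mathbf g}')\in E'$ and, with $l_j=\overline r.to$, either $((\mathbf k,\overline{\mathbf g}),\overline r,(\mathbf k',\overline{\mathbf g}'))\in\overline{\mathcal T}$, or $((\mathbf k,\overline{\mathbf g}),\overline r,(\mathbf k'+\mathbf u_j,\overline{\mathbf g}'))\in\overline{\mathcal T}$ and $\mathbf k'[j]=0$. Set $E_0=ERR$, $visitedTrans=\emptyset$. For $i=1,2,\dots$ while $E_{i-1}\ne\emptyset$: let $E_i$ be the set of first components of triples in $BasisTrans(E_{i-1})$ and add $BasisTrans(E_{i-1})$ to $visitedTrans$; then, for each $\overline\sigma\in E_i$ such that some other configuration $\overline\sigma_s\lesssim\overline\sigma$ lies in some $E_j$ with $j<i$ (equality allowed here) or in $E_i$, remove $\overline\sigma$ from $E_i$ and, for every such $\overline\sigma_s$, add to $visitedTrans$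 all triples $(\overline\sigma_s,\overline r,\overline\sigma')$ with $(\overline\sigma,\overline r,\overline\sigma')\in BasisTrans(E_{i-1})$. When the loop ends, if no computed $E_j$ meets $\overline\Sigma_0$, answer "safe". Otherwise build the error graph $errGraph$ consisting of all triples in $visitedTrans$ reachable from the configurations in $\bigcup_jE_j\cap\overline\Sigma_0$, enumerate its paths from $\overline\Sigma_0$ to $ERR$ (error paths) in breadth-first order by unfolding the graph, test each for non-spuriousness, and return a non-spurious one as soon as it is found; if all error paths are spurious, answer "safe". *)

theory Defs
  imports Complex_Main
begin

text \<open>Locations, shared variables and parameters are the elements of finite types \<open>'l\<close>, \<open>'x\<close>
  and \<open>'p\<close>; vectors over them are functions.\<close>

type_synonym 'p params = "'p \<Rightarrow> nat"

record 'p linexp =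
  const :: rat
  coeff :: "'p \<Rightarrow> rat"

definition lin_eval :: "('p::finite) linexp \<Rightarrow> 'p params \<Rightarrow> rat" where
  "lin_eval t p = const t + (\<Sum>i\<in>UNIV. coeff t i * of_nat (p i))"

definition const_exp :: "rat \<Rightarrow> 'p linexp" where
  "const_exp a = \<lparr>const = a, coeff = (\<lambda>_. 0)\<rparr>"

text \<open>Because of the divisibility atoms, the quantifier-free formulas below are as expressive as
  full linear integer arithmetic (Presburger, Cooper).
  \<open>Nonneg a b\<close> is \<open>0 \<le> a + \<Sum>\<^sub>i b\<^sub>i p\<^sub>i\<close> and \<open>Divs d a b\<close> is \<open>d dvd a + \<Sum>\<^sub>i b\<^sub>i p\<^sub>i\<close>.\<close>

datatype 'p lia =
    Nonneg int "'p \<Rightarrow> int"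
  | Divs int int "'p \<Rightarrow> int"
  | Neg "'p lia"
  | Conj "'p lia" "'p lia"
  | Disj "'p lia" "'p lia"

primrec lia_sat :: "('p::finite) params \<Rightarrow> 'p lia \<Rightarrow> bool" where
  "lia_sat p (Nonneg a b) \<longleftrightarrow> 0 \<le> a + (\<Sum>i\<in>UNIV. b i * int (p i))"
| "lia_sat p (Divs d a b) \<longleftrightarrow> d dvd a + (\<Sum>i\<in>UNIV. b i * int (p i))"
| "lia_sat p (Neg F) \<longleftrightarrow> \<not> lia_sat p F"
| "lia_sat p (Conj F G) \<longleftrightarrow> lia_sat p F \<and> lia_sat p G"
| "lia_sat p (Disj F G) \<longleftrightarrow> lia_sat p F \<or> lia_sat p G"

text \<open>\<open>Lower t x\<close> is the guard \<open>t \<le> x\<close>, and \<open>Upper t x\<close> is \<open>t > x\<close>.\<close>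

datatype ('x, 'p) atom = Lower "'p linexp" 'x | Upper "'p linexp" 'x

fun threshold :: "('x, 'p) atom \<Rightarrow> 'p linexp" where
  "threshold (Lower t x) = t"
| "threshold (Upper t x) = t"

text \<open>Rules are parametric in the type \<open>'g\<close> of guards, which is different for concrete and
  abstract rules.\<close>

record ('l, 'x, 'g) rule =
  src :: 'l
  tgt :: 'l
  guard :: 'g
  upd :: "'x \<Rightarrow> int"
  resets :: "'x set"

text \<open>A concrete guard is the conjunction of a list of atoms.\<close>

type_synonym ('l, 'x, 'p) crule = "('l, 'x, ('x, 'p) atom list) rule"

record ('l, 'x, 'p) ta =
  initial :: "'l set"
  rules :: "('l, 'x, 'p) crule set"
  rc :: "'p lia"
  procs :: "'p linexp"

definition admissible :: "('l, 'x, 'p::finite) ta \<Rightarrow> 'p params set" where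
  "admissible A = {p. lia_sat p (rc A)}"

definition threshold_automaton :: "('l::finite, 'x::finite, 'p::finite) ta \<Rightarrow> bool" where
  "threshold_automaton A \<longleftrightarrow>
     finite (rules A) \<and>
     (\<forall>r\<in>rules A. \<forall>x. upd r x \<in> {-1, 0, 1}) \<and>
     (\<forall>p\<in>admissible A. lin_eval (procs A) p \<in> \<nat>)"

definition thresholds :: "('l, 'x, 'p) ta \<Rightarrow> 'p linexp set" where
  "thresholds A = {threshold a | a r. r \<in> rules A \<and> a \<in> set (guard r)}"

text \<open>Guards are evaluated on integer vectors, since \<open>g - uv\<close> may have negative entries.\<close>

fun atom_sat :: "('p::finite) params \<Rightarrow> ('x \<Rightarrow> int) \<Rightarrow> ('x, 'p) atom \<Rightarrow> bool" where
  "atom_sat p g (Lower t x) \<longleftrightarrow> lin_eval t p \<le> of_int (g x)"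
| "atom_sat p g (Upper t x) \<longleftrightarrow> lin_eval t p > of_int (g x)"

definition guard_sat :: "('p::finite) params \<Rightarrow> ('x \<Rightarrow> int) \<Rightarrow> ('x, 'p) atom list \<Rightarrow> bool" where
  "guard_sat p g \<phi> \<longleftrightarrow> (\<forall>a\<in>set \<phi>. atom_sat p g a)"

record ('l, 'x, 'p) config =
  cnt :: "'l \<Rightarrow> nat"
  val :: "'x \<Rightarrow> nat"
  par :: "'p params"

definition unit_vec :: "'l \<Rightarrow> 'l \<Rightarrow> nat" where
  "unit_vec i l = (if l = i then 1 else 0)"

definition moves :: "('l, 'x, 'g) rule \<Rightarrow> ('l \<Rightarrow> nat) \<Rightarrow> ('l \<Rightarrow> nat) \<Rightarrow> bool" where
  "moves r k k' \<longleftrightarrow>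
     k (src r) \<ge> 1 \<and> k' = (\<lambda>l. k l - unit_vec (src r) l + unit_vec (tgt r) l)"

definition configs :: "('l::finite, 'x::finite, 'p::finite) ta \<Rightarrow> ('l, 'x, 'p) config set" where
  "configs A = {\<sigma>. par \<sigma> \<in> admissible A}"

definition init_configs :: "('l::finite, 'x::finite, 'p::finite) ta \<Rightarrow> ('l, 'x, 'p) config set" where
  "init_configs A =
     {\<sigma> \<in> configs A. (\<forall>x. val \<sigma> x = 0) \<and>
        of_nat (\<Sum>l\<in>initial A. cnt \<sigma> l) = lin_eval (procs A) (par \<sigma>) \<and>
        (\<Sum>l\<in>- initial A. cnt \<sigma> l) = 0}"

definition transitions ::
  "('l::finite, 'x::finite, 'p::finite) ta
     \<Rightarrow> (('l, 'x, 'p) config \<times> ('l, 'x, 'p) crule \<times> ('l, 'x, 'p) config) set" where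
  "transitions A =
     {(\<sigma>, r, \<sigma>'). \<sigma> \<in> configs A \<and> r \<in> rules A \<and> \<sigma>' \<in> configs A \<and>
        par \<sigma>' = par \<sigma> \<and>
        moves r (cnt \<sigma>) (cnt \<sigma>') \<and>
        guard_sat (par \<sigma>) (\<lambda>x. int (val \<sigma> x)) (guard r) \<and>
        (\<forall>x. int (val \<sigma>' x) = (if x \<in> resets r then 0 else int (val \<sigma> x) + upd r x))}"

text \<open>\<open>ds = [d\<^sub>0, \<dots>, d\<^sub>k]\<close> lists \<open>0\<close>, \<open>1\<close> and the thresholds of \<open>A\<close> in an order that all admissible
  parameters induce. Two thresholds that agree on all admissible parameters are the same \<open>d\<^sub>j\<close>;
  in particular, a guard may have the threshold \<open>0\<close> or \<open>1\<close>.\<close>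

definition threshold_order :: "('l, 'x, 'p::finite) ta \<Rightarrow> 'p linexp list \<Rightarrow> bool" where
  "threshold_order A ds \<longleftrightarrow>
     2 \<le> length ds \<and> ds ! 0 = const_exp 0 \<and> ds ! 1 = const_exp 1 \<and>
     (\<forall>i. 1 < i \<and> i < length ds \<longrightarrow> ds ! i \<in> thresholds A) \<and>
     (\<forall>t\<in>thresholds A. \<exists>j<length ds. \<forall>p\<in>admissible A. lin_eval t p = lin_eval (ds ! j) p) \<and>
     (\<forall>p\<in>admissible A. \<forall>i j. i < j \<and> j < length ds \<longrightarrow>
        lin_eval (ds ! i) p < lin_eval (ds ! j) p)"

definition threshold_index :: "('l, 'x, 'p::finite) ta \<Rightarrow> 'p linexp list \<Rightarrow> 'p linexp \<Rightarrow> nat" where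
  "threshold_index A ds t =
     (THE j. j < length ds \<and> (\<forall>p\<in>admissible A. lin_eval t p = lin_eval (ds ! j) p))"

text \<open>The endpoints of the interval \<open>I\<^sub>c\<close> depend on the parameters. In abstract configurations and
  guards, \<open>I\<^sub>c\<close> is represented by its index \<open>c \<in> {0, \<dots>, k}\<close>.\<close>

definition interval :: "('p::finite) linexp list \<Rightarrow> 'p params \<Rightarrow> nat \<Rightarrow> rat set" where
  "interval ds p c =
     (if Suc c < length ds then {lin_eval (ds ! c) p ..< lin_eval (ds ! Suc c) p}
      else {lin_eval (ds ! c) p ..})"

text \<open>An abstract guard is a conjunction of clauses; the clause \<open>(x, C)\<close> stands for the
  disjunction of \<open>x = I\<^sub>c\<close> over all \<open>c \<in> C\<close>.\<close>

type_synonym ('l, 'x) arule = "('l, 'x, ('x \<times> nat set) list) rule"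

record ('l, 'x) ata =
  ainitial :: "'l set"
  arules :: "('l, 'x) arule set"
  top_index :: nat

fun abs_atom :: "('l, 'x, 'p::finite) ta \<Rightarrow> 'p linexp list \<Rightarrow> ('x, 'p) atom \<Rightarrow> 'x \<times> nat set" where
  "abs_atom A ds (Lower t x) = (x, {threshold_index A ds t .. length ds - 1})"
| "abs_atom A ds (Upper t x) = (x, {..< threshold_index A ds t})"

definition abs_rule ::
  "('l, 'x, 'p::finite) ta \<Rightarrow> 'p linexp list \<Rightarrow> ('l, 'x, 'p) crule \<Rightarrow> ('l, 'x) arule" where
  "abs_rule A ds r =
     \<lparr>src = src r, tgt = tgt r, guard = map (abs_atom A ds) (guard r),
      upd = upd r, resets = resets r\<rparr>"

definition abs_ta :: "('l, 'x, 'p::finite) ta \<Rightarrow> 'p linexp list \<Rightarrow> ('l, 'x) ata" where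
  "abs_ta A ds =
     \<lparr>ainitial = initial A, arules = abs_rule A ds ` rules A, top_index = length ds - 1\<rparr>"

record ('l, 'x) aconfig =
  acnt :: "'l \<Rightarrow> nat"
  aval :: "'x \<Rightarrow> nat"

type_synonym ('l, 'x) atrans = "('l, 'x) aconfig \<times> ('l, 'x) arule \<times> ('l, 'x) aconfig"

definition aconfigs :: "('l::finite, 'x::finite) ata \<Rightarrow> ('l, 'x) aconfig set" where
  "aconfigs B = {\<sigma>. \<forall>x. aval \<sigma> x \<le> top_index B}"

definition init_aconfigs :: "('l::finite, 'x::finite) ata \<Rightarrow> ('l, 'x) aconfig set" where
  "init_aconfigs B =
     {\<sigma> \<in> aconfigs B. (\<forall>x. aval \<sigma> x = 0) \<and> (\<forall>l. l \<notin> ainitial B \<longrightarrow> acnt \<sigma> l = 0)}"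

definition aguard_sat :: "('x \<Rightarrow> nat) \<Rightarrow> ('x \<times> nat set) list \<Rightarrow> bool" where
  "aguard_sat g \<phi> \<longleftrightarrow> (\<forall>(x, C)\<in>set \<phi>. \<exists>c\<in>C. g x = c)"

definition interval_step :: "nat \<Rightarrow> int \<Rightarrow> nat \<Rightarrow> nat \<Rightarrow> bool" where
  "interval_step k u c c' \<longleftrightarrow>
     (u = 0 \<longrightarrow> c' = c) \<and>
     (u = 1 \<longrightarrow> (if c = 0 then c' = 1 else c' = c \<or> (c < k \<and> c' = c + 1))) \<and>
     (u = -1 \<longrightarrow> c' = c \<or> (0 < c \<and> c' = c - 1))"

definition atransitions :: "('l::finite, 'x::finite) ata \<Rightarrow> ('l, 'x) atrans set" where
  "atransitions B =
     {(\<sigma>, r, \<sigma>'). \<sigma> \<in> aconfigs B \<and> r \<in> arules B \<and> \<sigma>' \<in> aconfigs B \<and>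
        moves r (acnt \<sigma>) (acnt \<sigma>') \<and>
        aguard_sat (aval \<sigma>) (guard r) \<and>
        (\<forall>x. if x \<in> resets r then aval \<sigma>' x = 0
             else interval_step (top_index B) (upd r x) (aval \<sigma> x) (aval \<sigma>' x))}"

text \<open>The alternating sequence \<open>s\<^sub>0, r\<^sub>0, s\<^sub>1, \<dots>, r\<^bsub>m-1\<^esub>, s\<^sub>m\<close> is represented by
  \<open>(s\<^sub>0, [(r\<^sub>0, s\<^sub>1), \<dots>, (r\<^bsub>m-1\<^esub>, s\<^sub>m)])\<close>.\<close>

type_synonym ('s, 'r) sequence = "'s \<times> ('r \<times> 's) list"

definition seq_states :: "('s, 'r) sequence \<Rightarrow> 's list" where
  "seq_states \<pi> = fst \<pi> # map snd (snd \<pi>)"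

definition seq_last :: "('s, 'r) sequence \<Rightarrow> 's" where
  "seq_last \<pi> = last (seq_states \<pi>)"

definition seq_in :: "('s \<times> 'r \<times> 's) set \<Rightarrow> ('s, 'r) sequence \<Rightarrow> bool" where
  "seq_in T \<pi> \<longleftrightarrow>
     (\<forall>i<length (snd \<pi>). (seq_states \<pi> ! i, fst (snd \<pi> ! i), seq_states \<pi> ! Suc i) \<in> T)"

definition apath ::
  "('l::finite, 'x::finite) ata \<Rightarrow> (('l, 'x) aconfig, ('l, 'x) arule) sequence \<Rightarrow> bool" where
  "apath B \<pi> \<longleftrightarrow> fst \<pi> \<in> init_aconfigs B \<and> seq_in (atransitions B) \<pi>"

definition aleq :: "('l, 'x) aconfig \<Rightarrow> ('l, 'x) aconfig \<Rightarrow> bool" where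
  "aleq \<sigma> \<sigma>' \<longleftrightarrow> (\<forall>l. acnt \<sigma> l \<le> acnt \<sigma>' l) \<and> aval \<sigma> = aval \<sigma>'"

definition up :: "('l, 'x) aconfig set \<Rightarrow> ('l, 'x) aconfig set" where
  "up R = {\<sigma>. \<exists>\<sigma>'\<in>R. aleq \<sigma>' \<sigma>}"

definition concretize_step ::
  "('l, 'x, 'p::finite) crule \<Rightarrow> nat \<Rightarrow> ('l, 'x, 'p) config \<Rightarrow> ('l, 'x, 'p) config \<Rightarrow> bool" where
  "concretize_step r c \<sigma> \<sigma>' \<longleftrightarrow>
     (src r \<noteq> tgt r \<longrightarrow>
        cnt \<sigma> (src r) = c + cnt \<sigma>' (src r) \<and> cnt \<sigma>' (tgt r) = c + cnt \<sigma> (tgt r)) \<and>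
     (\<forall>x. x \<notin> resets r \<longrightarrow> int (val \<sigma>' x) = int (val \<sigma> x) + int c * upd r x) \<and>
     (\<forall>x. x \<in> resets r \<longrightarrow> val \<sigma>' x = 0) \<and>
     (c > 1 \<longrightarrow> guard_sat (par \<sigma>') (\<lambda>x. int (val \<sigma>' x) - upd r x) (guard r))"

definition nonspurious ::
  "('l::finite, 'x::finite, 'p::finite) ta \<Rightarrow> 'p linexp list
     \<Rightarrow> (('l, 'x) aconfig, ('l, 'x) arule) sequence \<Rightarrow> bool" where
  "nonspurious A ds \<pi> \<longleftrightarrow>
     (\<exists>(\<sigma> :: nat \<Rightarrow> ('l, 'x, 'p) config) (r :: nat \<Rightarrow> ('l, 'x, 'p) crule) (c :: nat \<Rightarrow> nat).
        \<sigma> 0 \<in> init_configs A \<and>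
        (\<forall>i<length (snd \<pi>).
           r i \<in> rules A \<and> abs_rule A ds (r i) = fst (snd \<pi> ! i) \<and>
           (\<sigma> i, \<sigma> (Suc i)) \<in> {(s, s'). (s, r i, s') \<in> transitions A} ^^ c i \<and>
           concretize_step (r i) (c i) (\<sigma> i) (\<sigma> (Suc i))) \<and>
        (\<forall>i\<le>length (snd \<pi>). \<forall>x.
           of_nat (val (\<sigma> i) x) \<in> interval ds (par (\<sigma> i)) (aval (seq_states \<pi> ! i) x)) \<and>
        (\<forall>l. acnt (seq_last \<pi>) l \<le> cnt (\<sigma> (length (snd \<pi>))) l))"

definition add_one :: "'l \<Rightarrow> ('l, 'x) aconfig \<Rightarrow> ('l, 'x) aconfig" where
  "add_one j \<sigma> = \<sigma>\<lparr>acnt := (\<lambda>l. acnt \<sigma> l + unit_vec j l)\<rparr>"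

definition basis_trans ::
  "('l::finite, 'x::finite) ata \<Rightarrow> ('l, 'x) aconfig set \<Rightarrow> ('l, 'x) atrans set" where
  "basis_trans B E =
     {(\<sigma>, r, \<sigma>'). \<sigma> \<in> aconfigs B \<and> r \<in> arules B \<and> \<sigma>' \<in> aconfigs B \<and> \<sigma>' \<in> E \<and>
        ((\<sigma>, r, \<sigma>') \<in> atransitions B \<or>
         (\<sigma>, r, add_one (tgt r) \<sigma>') \<in> atransitions B \<and> acnt \<sigma>' (tgt r) = 0)}"

text \<open>In the next three definitions, \<open>Es\<close> is the list \<open>[E\<^sub>0, \<dots>, E\<^bsub>i-1\<^esub>]\<close>. The configurations
  \<open>covering B Es \<sigma>\<close> are those because of which \<open>\<sigma>\<close> is removed from \<open>E\<^sub>i\<close>, where \<open>E\<^sub>i\<close> is taken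
  before any removal.\<close>

definition covering ::
  "('l::finite, 'x::finite) ata \<Rightarrow> ('l, 'x) aconfig set list \<Rightarrow> ('l, 'x) aconfig
     \<Rightarrow> ('l, 'x) aconfig set" where
  "covering B Es \<sigma> =
     {\<sigma>\<^sub>s. aleq \<sigma>\<^sub>s \<sigma> \<and>
        ((\<exists>E\<in>set Es. \<sigma>\<^sub>s \<in> E) \<or> (\<sigma>\<^sub>s \<in> fst ` basis_trans B (last Es) \<and> \<sigma>\<^sub>s \<noteq> \<sigma>))}"

definition next_level ::
  "('l::finite, 'x::finite) ata \<Rightarrow> ('l, 'x) aconfig set list \<Rightarrow> ('l, 'x) aconfig set" where
  "next_level B Es = {\<sigma> \<in> fst ` basis_trans B (last Es). covering B Es \<sigma> = {}}"

definition next_visited ::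
  "('l::finite, 'x::finite) ata \<Rightarrow> ('l, 'x) aconfig set list \<Rightarrow> ('l, 'x) atrans set" where
  "next_visited B Es =
     basis_trans B (last Es) \<union>
     {(\<sigma>\<^sub>s, r, \<sigma>') | \<sigma>\<^sub>s r \<sigma>' \<sigma>. (\<sigma>, r, \<sigma>') \<in> basis_trans B (last Es) \<and> \<sigma>\<^sub>s \<in> covering B Es \<sigma>}"

definition start_configs ::
  "('l::finite, 'x::finite) ata \<Rightarrow> ('l, 'x) aconfig set list \<Rightarrow> ('l, 'x) aconfig set" where
  "start_configs B Es = \<Union>(set Es) \<inter> init_aconfigs B"

definition err_graph :: "'s set \<Rightarrow> ('s \<times> 'r \<times> 's) set \<Rightarrow> ('s \<times> 'r \<times> 's) set" where
  "err_graph S V =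
     {(s, r, s') \<in> V. \<exists>s\<^sub>0\<in>S. (s\<^sub>0, s) \<in> {(a, b). \<exists>r. (a, r, b) \<in> V}\<^sup>*}"

definition extensions ::
  "('s \<times> 'r \<times> 's) set \<Rightarrow> ('s, 'r) sequence \<Rightarrow> ('s, 'r) sequence set" where
  "extensions G \<pi> = {(fst \<pi>, snd \<pi> @ [(r, s')]) | r s'. (seq_last \<pi>, r, s') \<in> G}"

datatype ('s, 'r) answer = Safe | Unsafe "('s, 'r) sequence"

text \<open>States of the algorithm: \<open>Backward Es V\<close> is the backward loop with computed levels \<open>Es\<close> and
  visited transitions \<open>V\<close>; \<open>Search G q\<close> is the breadth-first unfolding of the error graph \<open>G\<close> with
  queue \<open>q\<close>.\<close>

datatype ('s, 'r) state =
    Backward "'s set list" "('s \<times> 'r \<times> 's) set"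
  | Search "('s \<times> 'r \<times> 's) set" "('s, 'r) sequence list"
  | Answer "('s, 'r) answer"

text \<open>The algorithm is given by its execution steps; \<open>test\<close> decides non-spuriousness. The order in
  which paths of the same length are enumerated is left open. A step that would have to
  process an infinite set is not possible: the loop body requires \<open>basis_trans\<close> to be finite, and
  the queue is a list. Hence an algorithm that meets such a set gets stuck without an answer.\<close>

inductive alg_step ::
  "('l::finite, 'x::finite) ata \<Rightarrow> ('l, 'x) aconfig set
     \<Rightarrow> ((('l, 'x) aconfig, ('l, 'x) arule) sequence \<Rightarrow> bool)
     \<Rightarrow> (('l, 'x) aconfig, ('l, 'x) arule) state \<Rightarrow> (('l, 'x) aconfig, ('l, 'x) arule) state \<Rightarrow> bool"
  for B ERR test where
  loop: "last Es \<noteq> {} \<Longrightarrow> finite (basis_trans B (last Es)) \<Longrightarrow>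
    alg_step B ERR test (Backward Es V)
      (Backward (Es @ [next_level B Es]) (V \<union> next_visited B Es))"
| no_initial: "last Es = {} \<Longrightarrow> start_configs B Es = {} \<Longrightarrow>
    alg_step B ERR test (Backward Es V) (Answer Safe)"
| start_search: "last Es = {} \<Longrightarrow> start_configs B Es \<noteq> {} \<Longrightarrow>
    distinct q \<Longrightarrow> set q = (\<lambda>\<sigma>. (\<sigma>, [])) ` start_configs B Es \<Longrightarrow>
    alg_step B ERR test (Backward Es V) (Search (err_graph (start_configs B Es) V) q)"
| found: "seq_last \<pi> \<in> ERR \<Longrightarrow> test \<pi> \<Longrightarrow>
    alg_step B ERR test (Search G (\<pi> # q)) (Answer (Unsafe \<pi>))"
| unfold: "\<not> (seq_last \<pi> \<in> ERR \<and> test \<pi>) \<Longrightarrow>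
    distinct ext \<Longrightarrow> set ext = extensions G \<pi> \<Longrightarrow>
    alg_step B ERR test (Search G (\<pi> # q)) (Search G (q @ ext))"
| exhausted: "alg_step B ERR test (Search G []) (Answer Safe)"

definition alg_start :: "'s set \<Rightarrow> ('s, 'r) state" where
  "alg_start ERR = Backward [ERR] {}"

definition error_path ::
  "('l::finite, 'x::finite) ata \<Rightarrow> ('l, 'x) aconfig set
     \<Rightarrow> ((('l, 'x) aconfig, ('l, 'x) arule) sequence \<Rightarrow> bool)
     \<Rightarrow> (('l, 'x) aconfig, ('l, 'x) arule) sequence \<Rightarrow> bool" where
  "error_path B ERR test \<pi> \<longleftrightarrow>
     (\<exists>Es V. (alg_step B ERR test)\<^sup>*\<^sup>* (alg_start ERR) (Backward Es V) \<and> last Es = {} \<and>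
        fst \<pi> \<in> start_configs B Es \<and>
        seq_in (err_graph (start_configs B Es) V) \<pi> \<and>
        seq_last \<pi> \<in> ERR)"

text \<open>Every execution from \<open>s\<^sub>0\<close> is finite, and the state in which it stops satisfies \<open>Q\<close>.\<close>

definition terminates_in :: "('s \<Rightarrow> 's \<Rightarrow> bool) \<Rightarrow> 's \<Rightarrow> ('s \<Rightarrow> bool) \<Rightarrow> bool" where
  "terminates_in step s\<^sub>0 Q \<longleftrightarrow>
     (\<nexists>f. f 0 = s\<^sub>0 \<and> (\<forall>i::nat. step (f i) (f (Suc i)))) \<and>
     (\<forall>s. step\<^sup>*\<^sup>* s\<^sub>0 s \<and> (\<nexists>s'. step s s') \<longrightarrow> Q s)"

end

theory Submission
  imports Defs
begin

text \<open>Replacing the configurations of a path by smaller ones with respect to the order \<open>aleq\<close>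
  changes neither the rules nor the intervals and only weakens \<open>Cover\<close>, so it preserves
  non-spuriousness. Every predecessor of a configuration above a computed one lies above a
  predecessor in the basis, and pruning redirects each visited transition to a computed
  configuration that is smaller still. Hence a non-spurious path into the upward closure of the
  error configurations can be pulled down, from its end to its start, to a path of the error graph
  with the same rules; its start is initial because initial abstract configurations are closed
  downwards. The backward loop ends by Dickson's lemma, and breadth-first search reaches every path
  of a finite graph.\<close>

section \<open>Dickson's lemma\<close>

text \<open>Every sequence has a monotone subsequence. If that subsequence is decreasing, it attains
  its minimum at some \<open>N\<close> and is constant from there on, so its tail is also
  increasing.\<close>

lemma mono_subseq_nat:
  fixes f :: "nat \<Rightarrow> nat"
  shows "\<exists>\<phi> :: nat \<Rightarrow> nat. strict_mono \<phi> \<and> mono (f \<circ> \<phi>)"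
proof -
  obtain \<psi> where \<psi>: "strict_mono \<psi>" "monoseq (f \<circ> \<psi>)"
    using seq_monosub[of f] by (auto simp: comp_def)
  show ?thesis
  proof (cases "mono (f \<circ> \<psi>)")
    case True
    then show ?thesis using \<psi> by blast
  next
    case False
    then have dec: "f (\<psi> n) \<le> f (\<psi> m)" if "m \<le> n" for m n
      using \<psi>(2) that by (auto simp: monoseq_def mono_def)
    obtain N where N: "\<And>n. f (\<psi> N) \<le> f (\<psi> n)"
      using exists_least_iff[of "\<lambda>v. \<exists>n. v = f (\<psi> n)"] by (metis not_le)
    have "f (\<psi> (n + N)) = f (\<psi> N)" for n
      using N[of "n + N"] dec[of N "n + N"] by simp
    moreover have "strict_mono (\<lambda>n. \<psi> (n + N))"
      using \<psi>(1) by (simp add: strict_mono_def)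
    ultimately show ?thesis
      by (intro exI[of _ "\<lambda>n. \<psi> (n + N)"]) (simp add: mono_def)
  qed
qed

text \<open>Thin out the subsequence once per function; functions treated earlier stay monotone
  along any further subsequence.\<close>

lemma common_mono_subseq:
  fixes H :: "(nat \<Rightarrow> nat) set"
  assumes "finite H"
  shows "\<exists>\<phi> :: nat \<Rightarrow> nat. strict_mono \<phi> \<and> (\<forall>h\<in>H. mono (h \<circ> \<phi>))"
  using assms
proof (induction H)
  case empty
  show ?case by (rule exI[of _ id]) (simp add: strict_mono_def)
next
  case (insert h H)
  then obtain \<phi> :: "nat \<Rightarrow> nat" where \<phi>: "strict_mono \<phi>" "\<forall>h\<in>H. mono (h \<circ> \<phi>)" by blast
  obtain \<psi> :: "nat \<Rightarrow> nat" where \<psi>: "strict_mono \<psi>" "mono ((h \<circ> \<phi>) \<circ> \<psi>)"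
    using mono_subseq_nat by blast
  have "mono (g \<circ> (\<phi> \<circ> \<psi>))" if "g \<in> H" for g
    using \<phi>(2) that strict_mono_mono[OF \<psi>(1)] by (simp add: mono_def)
  moreover have "strict_mono (\<phi> \<circ> \<psi>)"
    using \<phi>(1) \<psi>(1) by (rule strict_mono_o)
  moreover have "mono (h \<circ> (\<phi> \<circ> \<psi>))"
    using \<psi>(2) by (simp only: o_assoc)
  ultimately show ?case by blast
qed

text \<open>Finitely many counters and intervals share one monotone subsequence, whose first two
  members are already comparable.\<close>

lemma aleq_wqo:
  fixes s :: "nat \<Rightarrow> ('l::finite, 'x::finite) aconfig"
  assumes "\<And>i. s i \<in> aconfigs B"
  shows "\<exists>i j. i < j \<and> aleq (s i) (s j)"
proof -
  \<comment> \<open>Monotonicity of both \<open>aval\<close> and its complement forces \<open>aval\<close> to be constant.\<close>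
  let ?H = "range (\<lambda>l i. acnt (s i) l) \<union> range (\<lambda>x i. aval (s i) x)
    \<union> range (\<lambda>x i. top_index B - aval (s i) x)"
  have "finite ?H" by simp
  from common_mono_subseq[OF this] obtain \<phi> :: "nat \<Rightarrow> nat"
    where \<phi>: "strict_mono \<phi>" "\<And>h. h \<in> ?H \<Longrightarrow> mono (h \<circ> \<phi>)"
    by blast
  have le: "h (\<phi> 0) \<le> h (\<phi> 1)" if "h \<in> ?H" for h
    using \<phi>(2)[OF that] by (simp add: mono_def)
  have "acnt (s (\<phi> 0)) l \<le> acnt (s (\<phi> 1)) l" for l
    using le[of "\<lambda>i. acnt (s i) l"] by auto
  moreover have "aval (s (\<phi> 0)) x = aval (s (\<phi> 1)) x" for x
  proof -
    have "aval (s i) x \<le> top_index B" for i using assms[of i] by (simp add: aconfigs_def)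
    moreover have "aval (s (\<phi> 0)) x \<le> aval (s (\<phi> 1)) x"
      using le[of "\<lambda>i. aval (s i) x"] by blast
    moreover have "top_index B - aval (s (\<phi> 0)) x \<le> top_index B - aval (s (\<phi> 1)) x"
      using le[of "\<lambda>i. top_index B - aval (s i) x"] by blast
    \<comment> \<open>Both values are at most \<open>top_index B\<close>, so the truncated
      subtraction really reverses the order.\<close>
    ultimately show ?thesis by (metis diff_le_mono2 diff_diff_cancel antisym)
  qed
  ultimately have "aleq (s (\<phi> 0)) (s (\<phi> 1))" by (auto simp: aleq_def)
  moreover have "\<phi> 0 < \<phi> 1" using \<phi>(1) by (simp add: strict_mono_def)
  ultimately show ?thesis by blast
qed

section \<open>Sequences\<close>

lemma seq_last_Nil [simp]: "seq_last (s, []) = s"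
  by (simp add: seq_last_def seq_states_def)

lemma seq_last_Cons [simp]: "seq_last (s, (r, s') # xs) = seq_last (s', xs)"
  by (simp add: seq_last_def seq_states_def)

lemma seq_in_Nil [simp]: "seq_in T (s, [])"
  by (simp add: seq_in_def)

lemma seq_in_Cons [simp]:
  "seq_in T (s, (r, s') # xs) \<longleftrightarrow> (s, r, s') \<in> T \<and> seq_in T (s', xs)"
proof -
  have "(\<forall>i<Suc n. P i) \<longleftrightarrow> P 0 \<and> (\<forall>i<n. P (Suc i))" for P and n :: nat
    by (auto simp: less_Suc_eq_0_disj)
  then show ?thesis by (simp add: seq_in_def seq_states_def)
qed

lemma seq_in_append [simp]:
  "seq_in T (s, xs @ ys) \<longleftrightarrow> seq_in T (s, xs) \<and> seq_in T (seq_last (s, xs), ys)"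
  by (induction xs arbitrary: s) auto

text \<open>The start \<open>s\<close> is only required to be reachable from \<open>S\<close>, so
  that the induction can advance along the sequence.\<close>

lemma seq_in_err_graph:
  assumes "seq_in V (s, xs)" "s\<^sub>0 \<in> S" "(s\<^sub>0, s) \<in> {(a, b). \<exists>r. (a, r, b) \<in> V}\<^sup>*"
  shows "seq_in (err_graph S V) (s, xs)"
  using assms
proof (induction xs arbitrary: s)
  case (Cons y ys)
  obtain r s' where y: "y = (r, s')" by (cases y)
  have "(s, r, s') \<in> V" using Cons.prems y by simp
  moreover from this have "(s\<^sub>0, s') \<in> {(a, b). \<exists>r. (a, r, b) \<in> V}\<^sup>*"
    using Cons.prems(3) by (auto intro: rtrancl_into_rtrancl)
  ultimately show ?case
    using Cons y by (auto simp: err_graph_def)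
qed simp

section \<open>Smaller sequences and non-spuriousness\<close>

definition seq_below ::
  "(('l, 'x) aconfig, 'r) sequence \<Rightarrow> (('l, 'x) aconfig, 'r) sequence \<Rightarrow> bool" where
  "seq_below \<pi>' \<pi> \<longleftrightarrow> aleq (fst \<pi>') (fst \<pi>) \<and>
     list_all2 (\<lambda>(r', s') (r, s). r' = r \<and> aleq s' s) (snd \<pi>') (snd \<pi>)"

lemma seq_below_states:
  assumes "seq_below \<pi>' \<pi>"
  shows "list_all2 aleq (seq_states \<pi>') (seq_states \<pi>)"
  using assms
  by (auto simp: seq_below_def seq_states_def list.rel_map split_beta elim: list.rel_mono_strong)

text \<open>The concrete run that witnesses \<open>\<pi>\<close>, with the same rules and repetition
  counts, also witnesses \<open>\<pi>'\<close>.\<close>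

lemma nonspurious_seq_below:
  fixes A :: "('l::finite, 'x::finite, 'p::finite) ta"
  assumes below: "seq_below \<pi>' \<pi>" and "nonspurious A ds \<pi>"
  shows "nonspurious A ds \<pi>'"
proof -
  have len: "length (snd \<pi>') = length (snd \<pi>)"
    using below by (auto simp: seq_below_def list_all2_lengthD)
  have rules: "fst (snd \<pi>' ! i) = fst (snd \<pi> ! i)" if "i < length (snd \<pi>)" for i
    using below that by (auto simp: seq_below_def list_all2_conv_all_nth split_beta)
  have vals: "aval (seq_states \<pi>' ! i) = aval (seq_states \<pi> ! i)" if "i \<le> length (snd \<pi>)" for i
    using list_all2_nthD2[OF seq_below_states[OF below], of i] that
    by (simp add: seq_states_def aleq_def)
  have "aleq (seq_last \<pi>') (seq_last \<pi>)"
    using list_all2_nthD2[OF seq_below_states[OF below], of "length (snd \<pi>)"] len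
    unfolding seq_last_def by (subst (1 2) last_conv_nth) (simp_all add: seq_states_def)
  then have last: "acnt (seq_last \<pi>') l \<le> acnt (seq_last \<pi>) l" for l
    by (simp add: aleq_def)
  from assms(2) obtain \<sigma> :: "nat \<Rightarrow> ('l, 'x, 'p) config" and r c where
    "\<sigma> 0 \<in> init_configs A"
    "\<forall>i<length (snd \<pi>).
       r i \<in> rules A \<and> abs_rule A ds (r i) = fst (snd \<pi> ! i) \<and>
       (\<sigma> i, \<sigma> (Suc i)) \<in> {(s, s'). (s, r i, s') \<in> transitions A} ^^ c i \<and>
       concretize_step (r i) (c i) (\<sigma> i) (\<sigma> (Suc i))"
    "\<forall>i\<le>length (snd \<pi>). \<forall>x.
       of_nat (val (\<sigma> i) x) \<in> interval ds (par (\<sigma> i)) (aval (seq_states \<pi> ! i) x)"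
    "\<forall>l. acnt (seq_last \<pi>) l \<le> cnt (\<sigma> (length (snd \<pi>))) l"
    unfolding nonspurious_def by blast
  then show ?thesis
    unfolding nonspurious_def len
    by (intro exI[of _ \<sigma>] exI[of _ r] exI[of _ c])
      (auto simp: rules vals intro: order_trans[OF last])
qed

section \<open>The backward loop\<close>

lemma aleq_refl [simp]: "aleq \<sigma> \<sigma>"
  by (simp add: aleq_def)

lemma aleq_trans: "aleq \<sigma> \<sigma>' \<Longrightarrow> aleq \<sigma>' \<sigma>'' \<Longrightarrow> aleq \<sigma> \<sigma>''"
  by (auto simp: aleq_def intro: order_trans)

lemma init_aconfigs_downward_closed:
  "\<sigma> \<in> init_aconfigs B \<Longrightarrow> aleq \<tau> \<sigma> \<Longrightarrow> \<tau> \<in> init_aconfigs B"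
  by (auto simp: init_aconfigs_def aconfigs_def aleq_def) (metis le_zero_eq)

lemma basis_trans_aconfigs: "(\<sigma>, r, \<sigma>') \<in> basis_trans B E \<Longrightarrow> \<sigma> \<in> aconfigs B"
  by (simp add: basis_trans_def)

lemma in_set_butlast: "x \<in> set xs \<Longrightarrow> x \<noteq> last xs \<Longrightarrow> x \<in> set (butlast xs)"
  by (cases xs rule: rev_cases) auto

text \<open>Undoing a move is monotone in the counters, while guards and interval steps depend only
  on the intervals, which \<open>t'\<close> shares with \<open>s'\<close>.\<close>

lemma atransition_basis_below:
  assumes tr: "(s, r, s') \<in> atransitions B" and t': "t' \<in> E" "aleq t' s'"
  shows "\<exists>t. aleq t s \<and> (t, r, t') \<in> basis_trans B E"
proof -
  have mv: "moves r (acnt s) (acnt s')" using tr by (simp add: atransitions_def)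
  \<comment> \<open>The move is undone by truncated subtraction. If \<open>t'\<close> has no process
    at \<open>tgt r\<close>, the actual successor of \<open>t\<close> is \<open>t''\<close>, with
    one process added there; this is the second clause of \<open>basis_trans\<close>.\<close>
  define t where
    "t = \<lparr>acnt = (\<lambda>l. acnt t' l - unit_vec (tgt r) l + unit_vec (src r) l), aval = aval s\<rparr>"
  define t'' where "t'' = (if acnt t' (tgt r) = 0 then add_one (tgt r) t' else t')"
  have le: "acnt t' l \<le> acnt s' l" for l using t'(2) by (simp add: aleq_def)
  have aval: "aval t' = aval s'" using t'(2) by (simp add: aleq_def)
  have "acnt t l \<le> acnt s l" for l
    using mv le[of l] by (auto simp: t_def moves_def unit_vec_def)
  then have "aleq t s" by (simp add: aleq_def t_def)
  moreover have "moves r (acnt t) (acnt t'')"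
    by (auto simp: t_def t''_def moves_def unit_vec_def add_one_def fun_eq_iff)
  then have "(t, r, t'') \<in> atransitions B"
    using tr aval
    by (auto simp: atransitions_def aconfigs_def t_def t''_def add_one_def)
  then have "(t, r, t') \<in> basis_trans B E"
    using tr t'(1) aval
    by (auto simp: basis_trans_def atransitions_def aconfigs_def t''_def add_one_def
        split: if_splits)
  ultimately show ?thesis by blast
qed

lemma moves_determines_source:
  assumes "moves r k k'"
  shows "k = (\<lambda>l. k' l - unit_vec (tgt r) l + unit_vec (src r) l)"
  using assms by (auto simp: moves_def unit_vec_def fun_eq_iff)

text \<open>A triple is determined by its rule, its target in \<open>E\<close>, the intervals of its
  source, and the Boolean \<open>e\<close> that tells which clause of \<open>basis_trans\<close>
  applies. The source counters follow, since moves can be undone uniquely.\<close>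

lemma finite_basis_trans:
  fixes B :: "('l::finite, 'x::finite) ata"
  assumes "finite (arules B)" "finite E"
  shows "finite (basis_trans B E)"
proof -
  let ?G = "{g :: 'x \<Rightarrow> nat. \<forall>x. (x \<in> UNIV \<longrightarrow> g x \<in> {..top_index B}) \<and> (x \<notin> UNIV \<longrightarrow> g x = 0)}"
  let ?pred = "\<lambda>(r, \<sigma>', g, e).
    (\<lparr>acnt = (\<lambda>l. acnt (if e then add_one (tgt r) \<sigma>' else \<sigma>') l
        - unit_vec (tgt r) l + unit_vec (src r) l), aval = g\<rparr>, r, \<sigma>')"
  have "(\<sigma>, r, \<sigma>') \<in> ?pred ` (arules B \<times> E \<times> ?G \<times> UNIV)"
    if bt: "(\<sigma>, r, \<sigma>') \<in> basis_trans B E" for \<sigma> r \<sigma>'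
  proof -
    obtain e where "moves r (acnt \<sigma>) (acnt (if e then add_one (tgt r) \<sigma>' else \<sigma>'))"
      using bt by (auto simp: basis_trans_def atransitions_def intro: that[of True] that[of False])
    from moves_determines_source[OF this]
    have "(\<sigma>, r, \<sigma>') = ?pred (r, \<sigma>', aval \<sigma>, e)" by simp
    moreover have "(r, \<sigma>', aval \<sigma>, e) \<in> arules B \<times> E \<times> ?G \<times> UNIV"
      using bt by (simp add: basis_trans_def aconfigs_def)
    ultimately show ?thesis by (rule image_eqI)
  qed
  then have "basis_trans B E \<subseteq> ?pred ` (arules B \<times> E \<times> ?G \<times> UNIV)" by auto
  moreover have "finite ?G" by (rule finite_set_of_finite_funs) auto
  then have "finite (?pred ` (arules B \<times> E \<times> ?G \<times> UNIV))"
    using assms by (intro finite_imageI finite_cartesian_product) auto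
  ultimately show ?thesis by (rule finite_subset)
qed

text \<open>A configuration that causes a removal may itself be removed in the same round. A
  candidate with the least total count survives, and since it lies below \<open>\<sigma>\<close>,
  the triple of \<open>\<sigma>\<close> is redirected to it directly.\<close>

lemma basis_representative:
  assumes "(\<sigma>, r, \<sigma>') \<in> basis_trans B (last Es)"
  shows "\<exists>\<tau>\<in>\<Union>(set (Es @ [next_level B Es])). aleq \<tau> \<sigma> \<and> (\<tau>, r, \<sigma>') \<in> next_visited B Es"
proof (cases "\<exists>\<tau>\<in>\<Union>(set Es). aleq \<tau> \<sigma>")
  case True
  then obtain \<tau> where "\<tau> \<in> \<Union>(set Es)" "aleq \<tau> \<sigma>" by blast
  then show ?thesis
    using assms by (auto simp: next_visited_def covering_def)
next
  case False
  let ?size = "\<lambda>\<tau>. \<Sum>l\<in>UNIV. acnt \<tau> l"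
  let ?P = "\<lambda>\<tau>. aleq \<tau> \<sigma> \<and> \<tau> \<in> fst ` basis_trans B (last Es)"
  have "?P \<sigma>" using assms by force
  then obtain \<tau> where \<tau>: "?P \<tau>" and least: "\<And>\<rho>. ?P \<rho> \<Longrightarrow> ?size \<tau> \<le> ?size \<rho>"
    using ex_has_least_nat[of ?P \<sigma> ?size] by blast
  have "covering B Es \<tau> = {}"
  proof (rule ccontr)
    \<comment> \<open>Earlier levels contain nothing below \<open>\<sigma>\<close>, so a covering
      configuration must come from the new basis; it would be a strictly smaller candidate.\<close>
    assume "covering B Es \<tau> \<noteq> {}"
    then obtain \<rho> where \<rho>: "aleq \<rho> \<tau>" "\<rho> \<in> fst ` basis_trans B (last Es)" "\<rho> \<noteq> \<tau>"
      using False \<tau> by (auto simp: covering_def dest: aleq_trans)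
    have "acnt \<rho> \<noteq> acnt \<tau>" using \<rho> by (auto simp: aleq_def)
    then obtain l where "acnt \<rho> l < acnt \<tau> l"
      using \<rho>(1) by (metis aleq_def ext le_neq_implies_less)
    then have "?size \<rho> < ?size \<tau>"
      using \<rho>(1) by (intro sum_strict_mono_ex1) (auto simp: aleq_def)
    moreover have "?P \<rho>" using \<rho> \<tau> aleq_trans by blast
    ultimately show False using least[of \<rho>] by simp
  qed
  then have "\<tau> \<in> next_level B Es" using \<tau> by (simp add: next_level_def)
  moreover have "(\<tau>, r, \<sigma>') \<in> next_visited B Es"
    using assms \<tau> by (cases "\<tau> = \<sigma>") (auto simp: next_visited_def covering_def)
  ultimately show ?thesis using \<tau> by auto
qed

section \<open>Invariant of the backward loop\<close>

text \<open>The last clause stops at \<open>butlast Es\<close> because the predecessors of the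
  newest level are not yet computed. Once that level is empty, every computed configuration is
  covered by the clause.\<close>

definition backward_inv ::
  "('l::finite, 'x::finite) ata \<Rightarrow> ('l, 'x) aconfig set \<Rightarrow> ('l, 'x) aconfig set list
     \<Rightarrow> ('l, 'x) atrans set \<Rightarrow> bool" where
  "backward_inv B ERR Es V \<longleftrightarrow>
     ERR \<in> set Es \<and> finite (\<Union>(set Es)) \<and> \<Union>(set Es) \<subseteq> aconfigs B \<and> finite V \<and>
     (\<forall>E\<in>set (butlast Es). \<forall>(\<sigma>, r, \<sigma>')\<in>basis_trans B E.
        \<exists>\<tau>\<in>\<Union>(set Es). aleq \<tau> \<sigma> \<and> (\<tau>, r, \<sigma>') \<in> V)"

lemma finite_last:
  assumes "backward_inv B ERR Es V"
  shows "finite (last Es)"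
proof -
  have "last Es \<in> set Es" using assms by (intro last_in_set) (auto simp: backward_inv_def)
  then show ?thesis
    using assms by (auto simp: backward_inv_def intro: finite_subset[OF Union_upper])
qed

lemma finite_next_visited:
  assumes "finite (basis_trans B (last Es))" "finite (\<Union>(set Es))"
  shows "finite (next_visited B Es)"
proof -
  let ?C = "\<Union>(set Es) \<union> fst ` basis_trans B (last Es)"
  have "next_visited B Es \<subseteq> basis_trans B (last Es) \<union> ?C \<times> snd ` basis_trans B (last Es)"
    by (force simp: next_visited_def covering_def)
  then show ?thesis
    by (rule finite_subset) (use assms in auto)
qed

text \<open>Only the old last level newly enters the range of the last clause, and
  \<open>basis_representative\<close> supplies its representatives.\<close>

lemma backward_inv_step:
  assumes inv: "backward_inv B ERR Es V" and fin: "finite (basis_trans B (last Es))"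
  shows "backward_inv B ERR (Es @ [next_level B Es]) (V \<union> next_visited B Es)"
proof -
  let ?Es = "Es @ [next_level B Es]" and ?V = "V \<union> next_visited B Es"
  have "next_level B Es \<subseteq> fst ` basis_trans B (last Es)" by (auto simp: next_level_def)
  then have "finite (next_level B Es)" "next_level B Es \<subseteq> aconfigs B"
    using fin finite_subset basis_trans_aconfigs by fastforce+
  moreover have "finite (next_visited B Es)"
    using inv fin by (auto simp: backward_inv_def intro!: finite_next_visited)
  moreover have "\<exists>\<tau>\<in>\<Union>(set ?Es). aleq \<tau> \<sigma> \<and> (\<tau>, r, \<sigma>') \<in> ?V"
    if E: "E \<in> set Es" and "(\<sigma>, r, \<sigma>') \<in> basis_trans B E" for E \<sigma> r \<sigma>'
  proof (cases "E \<in> set (butlast Es)")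
    case True
    then show ?thesis using inv that by (fastforce simp: backward_inv_def)
  next
    case False
    then have "E = last Es"
      using E in_set_butlast[of E Es] by blast
    then show ?thesis using basis_representative that by blast
  qed
  ultimately show ?thesis using inv by (auto simp: backward_inv_def)
qed

lemma pull_down:
  assumes inv: "backward_inv B ERR Es V" and "last Es = {}"
    and "seq_in (atransitions B) (s, xs)" "seq_last (s, xs) \<in> up ERR"
  shows "\<exists>\<pi>. seq_below \<pi> (s, xs) \<and> fst \<pi> \<in> \<Union>(set Es) \<and> seq_in V \<pi> \<and> seq_last \<pi> \<in> ERR"
  using assms(3,4)
proof (induction xs arbitrary: s)
  case Nil
  then obtain t where "t \<in> ERR" "aleq t s" by (auto simp: up_def)
  then show ?case
    using inv by (intro exI[of _ "(t, [])"]) (auto simp: backward_inv_def seq_below_def)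
next
  case (Cons y ys)
  obtain r s' where y: "y = (r, s')" by (cases y)
  obtain t' zs where \<pi>: "seq_below (t', zs) (s', ys)" "t' \<in> \<Union>(set Es)" "seq_in V (t', zs)"
    "seq_last (t', zs) \<in> ERR"
    using Cons.IH[of s'] Cons.prems y
    by (simp only: seq_in_Cons seq_last_Cons) (metis prod.collapse)
  then obtain E where E: "E \<in> set Es" "t' \<in> E" by blast
  \<comment> \<open>The final level is empty, so the level of \<open>t'\<close> has already been
    processed by the loop.\<close>
  have "E \<noteq> last Es" using assms(2) E by auto
  then have "E \<in> set (butlast Es)"
    using E in_set_butlast[of E Es] by blast
  moreover obtain t where t: "aleq t s" "(t, r, t') \<in> basis_trans B E"
    using atransition_basis_below[of s r s' B t' E] Cons.prems y \<pi>(1) E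
    by (auto simp: seq_below_def)
  ultimately obtain \<tau> where "\<tau> \<in> \<Union>(set Es)" "aleq \<tau> t" "(\<tau>, r, t') \<in> V"
    using inv unfolding backward_inv_def by blast
  \<comment> \<open>Redirection changes only the source of a triple: it still ends exactly in
    \<open>t'\<close>, so it can be put in front of the lowered tail.\<close>
  then show ?case
    using \<pi> t y
    by (intro exI[of _ "(\<tau>, (r, t') # zs)"]) (auto simp: seq_below_def intro: aleq_trans)
qed

section \<open>Termination of the backward loop\<close>

text \<open>An infinite loop yields a surviving configuration in every level. By Dickson's lemma a
  later one lies above an earlier one, but then pruning would have removed it.\<close>

lemma backward_loop_wf:
  assumes "\<And>i. f i = Backward (Es i) (V i)" "\<And>i. alg_step B ERR test (f i) (f (Suc i))"
  shows False
proof -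
  have nonempty: "last (Es i) \<noteq> {}" and step: "Es (Suc i) = Es i @ [next_level B (Es i)]" for i
  proof -
    have "alg_step B ERR test (Backward (Es i) (V i)) (Backward (Es (Suc i)) (V (Suc i)))"
      using assms by metis
    then show "last (Es i) \<noteq> {}" "Es (Suc i) = Es i @ [next_level B (Es i)]"
      by (auto elim: alg_step.cases)
  qed
  have "\<exists>\<sigma>. \<sigma> \<in> next_level B (Es i)" for i
    using nonempty[of "Suc i"] step[of i] by auto
  then obtain s where s: "\<And>i. s i \<in> next_level B (Es i)" by metis
  have "s i \<in> aconfigs B" for i
    using s[of i] by (auto simp: next_level_def dest: basis_trans_aconfigs)
  then obtain i j where ij: "i < j" "aleq (s i) (s j)" using aleq_wqo by blast
  have "next_level B (Es i) \<in> set (Es j)"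
    using ij(1)
  proof (induction j)
    case (Suc j)
    then show ?case by (cases "i = j") (auto simp: step)
  qed simp
  then have "s i \<in> covering B (Es j) (s j)"
    using s[of i] ij(2) by (auto simp: covering_def)
  then show False using s[of j] by (auto simp: next_level_def)
qed

section \<open>The search\<close>

lemma finite_extensions:
  assumes "finite G"
  shows "finite (extensions G \<pi>)"
proof -
  have "extensions G \<pi> \<subseteq> (\<lambda>(s, r, s'). (fst \<pi>, snd \<pi> @ [(r, s')])) ` G"
    by (force simp: extensions_def)
  then show ?thesis using assms finite_surj by blast
qed

lemma extensions_prefix:
  assumes "seq_in G \<pi>" "n < length (snd \<pi>)"
  shows "(fst \<pi>, take (Suc n) (snd \<pi>)) \<in> extensions G (fst \<pi>, take n (snd \<pi>))"
proof -
  obtain r s' where y: "snd \<pi> ! n = (r, s')" by (cases "snd \<pi> ! n")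
  have tk: "take (Suc n) (snd \<pi>) = take n (snd \<pi>) @ [(r, s')]"
    using assms(2) y by (simp add: take_Suc_conv_app_nth)
  have "seq_in G (fst \<pi>, take (Suc n) (snd \<pi>) @ drop (Suc n) (snd \<pi>))"
    using assms(1) by simp
  then have "(seq_last (fst \<pi>, take n (snd \<pi>)), r, s') \<in> G"
    unfolding seq_in_append tk by simp
  then show ?thesis using tk by (auto simp: extensions_def)
qed

text \<open>Each step removes the head of the queue and appends at the back, so the part
  \<open>xs\<close> in front of \<open>\<pi>\<close> shrinks by one.\<close>

lemma search_dequeues:
  assumes run: "\<And>i. f i = Search G (q i)" "\<And>i. alg_step B ERR test (f i) (f (Suc i))"
    and "q i = xs @ \<pi> # ys"
  shows "\<exists>j ext. q j = \<pi> # ext"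
  using assms(3)
proof (induction xs arbitrary: i ys)
  case (Cons x xs)
  have "alg_step B ERR test (Search G (q i)) (Search G (q (Suc i)))"
    using run by metis
  then obtain ext where "q (Suc i) = (xs @ \<pi> # ys) @ ext"
    using Cons.prems by (auto elim: alg_step.cases)
  then show ?case using Cons.IH by auto
qed auto

text \<open>Downward induction from the full length of \<open>\<pi>\<close>: a queued prefix
  eventually becomes the head and is replaced by its extensions, among them the next longer prefix.
  With \<open>\<pi>\<close> itself at the head, \<open>unfold\<close> is blocked and the search must
  stop.\<close>

lemma search_wf:
  assumes run: "\<And>i. f i = Search G (q i)" "\<And>i. alg_step B ERR test (f i) (f (Suc i))"
    and \<pi>: "seq_in G \<pi>" "seq_last \<pi> \<in> ERR" "test \<pi>"
    and "n \<le> length (snd \<pi>)" "(fst \<pi>, take n (snd \<pi>)) \<in> set (q i)"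
  shows False
  using assms(6,7)
proof (induction n arbitrary: i rule: inc_induct)
  case base
  then obtain j ext where "q j = \<pi> # ext"
    using search_dequeues[where f = f and q = q, OF run] by (fastforce dest: split_list)
  moreover have "alg_step B ERR test (Search G (q j)) (Search G (q (Suc j)))"
    using run by metis
  ultimately show ?case using \<pi> by (auto elim: alg_step.cases)
next
  case (step n)
  then obtain j ext where j: "q j = (fst \<pi>, take n (snd \<pi>)) # ext"
    using search_dequeues[where f = f and q = q, OF run] by (fastforce dest: split_list)
  have "alg_step B ERR test (Search G (q j)) (Search G (q (Suc j)))"
    using run by metis
  then have "extensions G (fst \<pi>, take n (snd \<pi>)) \<subseteq> set (q (Suc j))"
    using j by (auto elim: alg_step.cases)
  then show ?case using step extensions_prefix[OF \<pi>(1)] by blast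
qed

section \<open>Termination and completeness\<close>

text \<open>During the search some prefix of a passing error path is always queued, so the queue
  cannot run empty. The backward run is remembered because \<open>error_path\<close> refers to it.
  The clause for answers rules out \<open>Safe\<close>.\<close>

primrec state_inv ::
  "('l::finite, 'x::finite) ata \<Rightarrow> ('l, 'x) aconfig set
     \<Rightarrow> ((('l, 'x) aconfig, ('l, 'x) arule) sequence \<Rightarrow> bool)
     \<Rightarrow> (('l, 'x) aconfig, ('l, 'x) arule) state \<Rightarrow> bool" where
  "state_inv B ERR test (Backward Es V) \<longleftrightarrow>
     (alg_step B ERR test)\<^sup>*\<^sup>* (alg_start ERR) (Backward Es V) \<and> backward_inv B ERR Es V"
| "state_inv B ERR test (Search G q) \<longleftrightarrow>
     (\<exists>Es V. (alg_step B ERR test)\<^sup>*\<^sup>* (alg_start ERR) (Backward Es V) \<and>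
        backward_inv B ERR Es V \<and> last Es = {} \<and> G = err_graph (start_configs B Es) V \<and>
        (\<forall>\<pi>\<in>set q. fst \<pi> \<in> start_configs B Es \<and> seq_in G \<pi>)) \<and>
     (\<exists>\<pi> n. seq_in G \<pi> \<and> seq_last \<pi> \<in> ERR \<and> test \<pi> \<and>
        n \<le> length (snd \<pi>) \<and> (fst \<pi>, take n (snd \<pi>)) \<in> set q)"
| "state_inv B ERR test (Answer a) \<longleftrightarrow>
     (\<exists>\<pi>. a = Unsafe \<pi> \<and> error_path B ERR test \<pi> \<and> test \<pi>)"

lemma finite_err_graph: "backward_inv B ERR Es V \<Longrightarrow> finite (err_graph S V)"
  by (rule finite_subset[of _ V]) (auto simp: err_graph_def backward_inv_def)

lemma seq_in_extension:
  "seq_in G \<pi> \<Longrightarrow> \<pi>' \<in> extensions G \<pi> \<Longrightarrow> fst \<pi>' = fst \<pi> \<and> seq_in G \<pi>'"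
  by (cases \<pi>) (auto simp: extensions_def)

text \<open>Here \<open>test\<close> stands for non-spuriousness; the argument works for any
  predicate closed under \<open>seq_below\<close>.\<close>

locale coverable =
  fixes B :: "('l::finite, 'x::finite) ata"
    and ERR :: "('l, 'x) aconfig set"
    and test :: "(('l, 'x) aconfig, ('l, 'x) arule) sequence \<Rightarrow> bool"
  assumes finite_arules: "finite (arules B)"
    and finite_ERR: "finite ERR" and ERR_aconfigs: "ERR \<subseteq> aconfigs B"
    and test_below: "\<And>\<pi> \<pi>'. seq_below \<pi>' \<pi> \<Longrightarrow> test \<pi> \<Longrightarrow> test \<pi>'"
    and witness: "\<exists>\<pi>. apath B \<pi> \<and> seq_last \<pi> \<in> up ERR \<and> test \<pi>"
begin

abbreviation "step \<equiv> alg_step B ERR test"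

text \<open>This rules out the answer \<open>Safe\<close> after the loop and provides the path that
  the search is bound to reach. The lowered path starts in a configuration that is both computed and
  initial, so all its triples are reachable in the error graph.\<close>

lemma error_graph_witness:
  assumes "backward_inv B ERR Es V" "last Es = {}"
  shows "\<exists>\<pi>. fst \<pi> \<in> start_configs B Es \<and> seq_in (err_graph (start_configs B Es) V) \<pi> \<and>
    seq_last \<pi> \<in> ERR \<and> test \<pi>"
proof -
  obtain s xs where \<pi>: "apath B (s, xs)" "seq_last (s, xs) \<in> up ERR" "test (s, xs)"
    using witness by (metis surj_pair)
  then obtain t ys where \<pi>': "seq_below (t, ys) (s, xs)" "t \<in> \<Union>(set Es)" "seq_in V (t, ys)"
    "seq_last (t, ys) \<in> ERR"
    using pull_down[OF assms, of s xs] by (auto simp: apath_def)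
  then have t: "t \<in> start_configs B Es"
    using \<pi>(1) init_aconfigs_downward_closed
    by (auto simp: start_configs_def apath_def seq_below_def)
  then have "seq_in (err_graph (start_configs B Es) V) (t, ys)"
    using \<pi>'(3) by (auto intro: seq_in_err_graph[of V t ys t])
  moreover have "test (t, ys)" using test_below[OF \<pi>'(1) \<pi>(3)] .
  ultimately show ?thesis using t \<pi>'(4) by (intro exI[of _ "(t, ys)"]) simp
qed

lemma state_inv_start: "state_inv B ERR test (alg_start ERR)"
  using finite_ERR ERR_aconfigs by (auto simp: alg_start_def backward_inv_def)

lemma state_inv_step:
  assumes "step s s'" "state_inv B ERR test s"
  shows "state_inv B ERR test s'"
  using assms
proof (induction rule: alg_step.induct)
  case (loop Es V)
  then show ?case
    by (auto intro: backward_inv_step alg_step.loop rtranclp.rtrancl_into_rtrancl)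
next
  case (no_initial Es V)
  then show ?case using error_graph_witness[of Es V] by auto
next
  case (start_search Es q V)
  let ?S = "start_configs B Es"
  have inv: "backward_inv B ERR Es V" using start_search.prems by simp
  obtain \<pi> where \<pi>: "fst \<pi> \<in> ?S" "seq_in (err_graph ?S V) \<pi>" "seq_last \<pi> \<in> ERR" "test \<pi>"
    using error_graph_witness[OF inv start_search.hyps(1)] by blast
  \<comment> \<open>The empty prefix of the witness is one of the initial queue entries.\<close>
  have "(fst \<pi>, take 0 (snd \<pi>)) \<in> set q" using \<pi>(1) start_search.hyps(4) by simp
  then have "\<exists>\<pi> n. seq_in (err_graph ?S V) \<pi> \<and> seq_last \<pi> \<in> ERR \<and> test \<pi> \<and>
      n \<le> length (snd \<pi>) \<and> (fst \<pi>, take n (snd \<pi>)) \<in> set q"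
    using \<pi> by blast
  moreover have "\<forall>\<pi>\<in>set q. fst \<pi> \<in> ?S \<and> seq_in (err_graph ?S V) \<pi>"
    using start_search.hyps(4) by auto
  ultimately show ?case
    using start_search.prems start_search.hyps(1) unfolding state_inv.simps by blast
next
  case (found \<pi> G q)
  then show ?case by (auto simp: error_path_def)
next
  case (unfold \<pi> ext G q)
  obtain Es V where G: "step\<^sup>*\<^sup>* (alg_start ERR) (Backward Es V)" "backward_inv B ERR Es V"
    "last Es = {}" "G = err_graph (start_configs B Es) V"
    and paths: "\<And>\<rho>. \<rho> \<in> set (\<pi> # q) \<Longrightarrow> fst \<rho> \<in> start_configs B Es \<and> seq_in G \<rho>"
    using unfold.prems unfolding state_inv.simps by blast
  have "\<forall>\<rho>\<in>set (q @ ext). fst \<rho> \<in> start_configs B Es \<and> seq_in G \<rho>"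
    using paths seq_in_extension[of G \<pi>] unfold.hyps(3)
    by (metis Un_iff list.set_intros set_append)
  moreover obtain \<rho> n where \<rho>: "seq_in G \<rho>" "seq_last \<rho> \<in> ERR" "test \<rho>"
    "n \<le> length (snd \<rho>)" "(fst \<rho>, take n (snd \<rho>)) \<in> set (\<pi> # q)"
    using unfold.prems unfolding state_inv.simps by blast
  have "\<exists>n\<le>length (snd \<rho>). (fst \<rho>, take n (snd \<rho>)) \<in> set (q @ ext)"
  proof (cases "(fst \<rho>, take n (snd \<rho>)) \<in> set q")
    case True
    then show ?thesis using \<rho>(4) by auto
  next
    case False
    then have \<pi>: "\<pi> = (fst \<rho>, take n (snd \<rho>))" using \<rho>(5) by auto
    \<comment> \<open>The dequeued entry is the tracked prefix. It is a proper one, as the full path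
      would have been returned; hence its extension by one step is in \<open>ext\<close>.\<close>
    then have "n \<noteq> length (snd \<rho>)" using unfold.hyps(1) \<rho>(2,3) by auto
    then show ?thesis
      using \<rho>(4) extensions_prefix[OF \<rho>(1), of n] \<pi> unfold.hyps(3)
      by (intro exI[of _ "Suc n"]) auto
  qed
  ultimately show ?case using G \<rho>(1-3) unfolding state_inv.simps by blast
next
  case (exhausted G)
  then show ?case by simp
qed

text \<open>The invariant keeps levels and visited transitions finite, so no step is blocked by an
  infinite set and a run can stop only with an answer.\<close>

lemma state_inv_progress:
  assumes "state_inv B ERR test s" "\<nexists>s'. step s s'"
  shows "\<exists>a. s = Answer a"
proof (cases s)
  case (Backward Es V)
  then have inv: "backward_inv B ERR Es V" using assms(1) by simp
  have "finite (start_configs B Es)"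
    using inv by (auto simp: backward_inv_def start_configs_def)
  then obtain q :: "(('l, 'x) aconfig, ('l, 'x) arule) sequence list" where
    q: "set q = (\<lambda>\<sigma>. (\<sigma>, [])) ` start_configs B Es" "distinct q"
    using finite_distinct_list[of "(\<lambda>\<sigma>. (\<sigma>, [])) ` start_configs B Es"] by blast
  have "finite (basis_trans B (last Es))"
    using finite_arules finite_last[OF inv] by (rule finite_basis_trans)
  then have "\<exists>s'. step s s'"
    using alg_step.loop[of Es B ERR test V] alg_step.no_initial[of Es B ERR test V]
      alg_step.start_search[OF _ _ q(2,1), of ERR test V] Backward by blast
  then show ?thesis using assms(2) by blast
next
  case (Search G q)
  show ?thesis
  proof (cases q)
    case Nil
    then show ?thesis using assms(2) Search alg_step.exhausted by blast
  next
    case (Cons \<pi> q')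
    have "finite G" using assms(1) Search by (auto intro: finite_err_graph)
    then obtain ext where ext: "set ext = extensions G \<pi>" "distinct ext"
      using finite_distinct_list[OF finite_extensions] by metis
    then have "\<exists>s'. step s s'"
      using alg_step.found[of \<pi> ERR test B G q'] alg_step.unfold[of \<pi> ERR test ext G B q']
        Search Cons by blast
    then show ?thesis using assms(2) by blast
  qed
qed simp

lemma no_infinite_run:
  assumes "f 0 = alg_start ERR" and run: "\<And>i. step (f i) (f (Suc i))"
  shows False
proof (cases "\<exists>i G q. f i = Search G q")
  case True
  then obtain i G q where i: "f i = Search G q" by blast
  have inv: "state_inv B ERR test (f i)" for i
    by (induction i) (auto simp: assms(1) state_inv_start intro: state_inv_step run)
  \<comment> \<open>Answers have no successor, so an infinite run that has entered the search stays
    in it, always with the same graph \<open>G\<close>.\<close>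
  have "\<exists>q. f (i + j) = Search G q" for j
  proof (induction j)
    case (Suc j)
    then have "(\<exists>q. f (i + Suc j) = Search G q) \<or> (\<exists>a. f (i + Suc j) = Answer a)"
      using run[of "i + j"] by (auto elim: alg_step.cases)
    moreover have "\<not> step (Answer a) s" for a s by (auto elim: alg_step.cases)
    ultimately show ?case using run[of "i + Suc j"] by auto
  qed (use i in simp)
  then obtain qs where qs: "\<And>j. f (i + j) = Search G (qs j)" by metis
  have "step (f (i + j)) (f (i + Suc j))" for j using run[of "i + j"] by simp
  moreover obtain \<pi> n where "seq_in G \<pi>" "seq_last \<pi> \<in> ERR" "test \<pi>"
      "n \<le> length (snd \<pi>)" "(fst \<pi>, take n (snd \<pi>)) \<in> set (qs 0)"
    using inv[of "i + 0"] unfolding qs state_inv.simps by blast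
  ultimately show False
    using search_wf[where f = "\<lambda>j. f (i + j)" and q = qs, OF qs] by blast
next
  case False
  \<comment> \<open>With searches excluded and answers final, an infinite run never leaves the
    backward loop.\<close>
  have "\<exists>Es V. f i = Backward Es V" for i
    using False run[of i] by (cases "f i") (auto elim: alg_step.cases)
  then obtain Es V where "\<And>i. f i = Backward (Es i) (V i)" by metis
  then show False using backward_loop_wf run by blast
qed

lemma complete:
  "terminates_in step (alg_start ERR)
    (\<lambda>s. \<exists>\<pi>. s = Answer (Unsafe \<pi>) \<and> error_path B ERR test \<pi> \<and> test \<pi>)"
proof -
  have inv: "state_inv B ERR test s" if "step\<^sup>*\<^sup>* (alg_start ERR) s" for s
    using that by (induction rule: rtranclp_induct) (auto intro: state_inv_start state_inv_step)
  show ?thesis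
    unfolding terminates_in_def
  proof (intro conjI allI impI notI)
    fix s assume "step\<^sup>*\<^sup>* (alg_start ERR) s \<and> (\<nexists>s'. step s s')"
    then show "\<exists>\<pi>. s = Answer (Unsafe \<pi>) \<and> error_path B ERR test \<pi> \<and> test \<pi>"
      using inv[of s] state_inv_progress[of s] by auto
  qed (use no_infinite_run in blast)
qed

end

theorem lemma5:
  fixes A :: "('l::finite, 'x::finite, 'p::finite) ta"
    and ds :: "'p linexp list"
    and ERR :: "('l, 'x) aconfig set"
  assumes "threshold_automaton A"
    and "threshold_order A ds"
    and "finite ERR" and "ERR \<subseteq> aconfigs (abs_ta A ds)"
    and "\<exists>\<pi>. apath (abs_ta A ds) \<pi> \<and> seq_last \<pi> \<in> up ERR \<and> nonspurious A ds \<pi>"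
  shows "terminates_in (alg_step (abs_ta A ds) ERR (nonspurious A ds)) (alg_start ERR)
    (\<lambda>s. \<exists>\<pi>. s = Answer (Unsafe \<pi>) \<and>
       error_path (abs_ta A ds) ERR (nonspurious A ds) \<pi> \<and> nonspurious A ds \<pi>)"
proof -
  \<comment> \<open>The abstract rules are the image of the finitely many concrete ones, and
    \<open>nonspurious_seq_below\<close> gives closure of the test.\<close>
  interpret coverable "abs_ta A ds" ERR "nonspurious A ds"
    using assms nonspurious_seq_below
    by unfold_locales (auto simp: threshold_automaton_def abs_ta_def)
  show ?thesis by (rule complete)
qed

end
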